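(* Let $q_1,q_2$ be positive constants and let $n,r$ be integers with $1<r<n$. (a) The function $\rho_1(X)=\|X_-\|_F^{q_1}+\|\sigma(X)-\mathbf{1}\|_2^{q_2}$ defines a local error bound for $\mathbb{S}^{n,r}_+$ relative to $\mathbb{R}^{n\times r}$ if and only if $q_1\le 1/2$ and $q_2\le1/2$, but it does not define a global error bound for $\mathbb{S}^{n,r}_+$ relative to $\mathbb{R}^{n\times r}$, no matter what values $q_1$ and $q_2$ take. (b) The function $\rho_2(X)=\|X_-\|_F^{q_1}+\|X^{T}X-I_r\|_F^{q_2}$ defines a local error bound for $\mathbb{S}^{n,r}_+$ relative to $\mathbb{R}^{n\times r}$ if and only if $q_1\le1/2$ and $q_2\le 1/2$, and it defines a global error bound for $\mathbb{S}^{n,r}_+$ relative to $\mathbb{R}^{n\times r}$ if and only if $q_1\le q_2=1/2$.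
   Context: $\mathbb{S}^{n,r}_+=\{X\in\mathbb{R}^{n\times r}:X^{T}X=I_r,\ X\ge0\}$ (entry-wise inequality) is the nonnegative Stiefel manifold. For a matrix $Y$, $Y_-=\max\{-Y,0\}$ entry-wise. $\sigma(X)\in\mathbb{R}^r$ is the vector of singular values of $X\in\mathbb{R}^{n\times r}$ in descending order, $\mathbf{1}$ is the all-ones vector, $\|\cdot\|_2$ the Euclidean vector norm, $\|\cdot\|_F$ the Frobenius norm, and $\operatorname{dist}$ the distance to a set in the Frobenius norm. A function $\rho:\mathbb{R}^{n\times r}\to[0,\infty)$ defines a local error bound for $\mathbb{S}^{n,r}_+$ relative to $\mathbb{R}^{n\times r}$ if there exist positive constants $\epsilon$ and $\nu$ such that $\operatorname{dist}(X,\mathbb{S}^{n,r}_+)\le\nu\rho(X)$ for all $X\in\mathbb{R}^{n\times r}$ satisfying $\|X_-\|_F+\|X^{T}X-I_r\|_F\le\epsilon$. It defines a global error bound for $\mathbb{S}^{n,r}_+$ relative to $\mathbb{R}^{n\times r}$ if there exists a positive constant $\nu$ such that this inequality holds for all $X\in\mathbb{R}^{n\times r}$. *)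

theory Defs
  imports "HOL-Analysis.Analysis" "HOL-Computational_Algebra.Computational_Algebra"
begin

text \<open>
  An \<open>n \<times> r\<close> real matrix is an element of \<^typ>\<open>real^'r^'n\<close> with \<open>n = CARD('n)\<close> and
  \<open>r = CARD('r)\<close>. The library norm of this type is the root of the sum of the squares of all
  entries, i.e. the Frobenius norm, so \<^const>\<open>norm\<close> and \<^const>\<open>infdist\<close> are the Frobenius norm
  and the Frobenius distance to a set.
\<close>

definition nonneg_stiefel :: "(real^'r^'n) set" where
  "nonneg_stiefel =
     {X. transpose X ** X = mat 1 \<and> (\<forall>i j. 0 \<le> X $ i $ j)}"

definition neg_part :: "real^'r^'n \<Rightarrow> real^'r^'n" where
  "neg_part Y = (\<chi> i j. max (- (Y $ i $ j)) 0)"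

definition charpoly :: "'a::comm_ring_1^'n^'n \<Rightarrow> 'a poly" where
  "charpoly A = det (\<chi> i j. (if i = j then [:0, 1:] else 0) - [:A $ i $ j:])"

text \<open>
  The singular values of \<open>X\<close> are the square roots of the eigenvalues of the \<open>r \<times> r\<close> Gram matrix
  \<open>X\<^sup>T X\<close>, repeated according to multiplicity. That matrix is symmetric positive semidefinite, so
  its characteristic polynomial has \<open>r\<close> nonnegative real roots counted with multiplicity and the
  list below has length \<open>r\<close>.
\<close>

definition singular_values :: "real^'r^'n \<Rightarrow> real list" where
  "singular_values X =
     rev (sorted_list_of_multiset
       (image_mset sqrt (proots (charpoly (transpose X ** X)))))"

definition local_error_bound :: "(real^'r^'n \<Rightarrow> real) \<Rightarrow> bool" where
  "local_error_bound \<rho> \<longleftrightarrow>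
     (\<forall>X. 0 \<le> \<rho> X) \<and>
     (\<exists>\<epsilon> \<nu>. 0 < \<epsilon> \<and> 0 < \<nu> \<and>
        (\<forall>X. norm (neg_part X) + norm (transpose X ** X - mat 1) \<le> \<epsilon> \<longrightarrow>
             infdist X nonneg_stiefel \<le> \<nu> * \<rho> X))"

definition global_error_bound :: "(real^'r^'n \<Rightarrow> real) \<Rightarrow> bool" where
  "global_error_bound \<rho> \<longleftrightarrow>
     (\<forall>X. 0 \<le> \<rho> X) \<and>
     (\<exists>\<nu>. 0 < \<nu> \<and> (\<forall>X. infdist X nonneg_stiefel \<le> \<nu> * \<rho> X))"

definition rho1 :: "real \<Rightarrow> real \<Rightarrow> real^'r^'n \<Rightarrow> real" where
  "rho1 q\<^sub>1 q\<^sub>2 X =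
     norm (neg_part X) powr q\<^sub>1 +
     (L2_set (\<lambda>i. singular_values X ! i - 1) {..<CARD('r)}) powr q\<^sub>2"

definition rho2 :: "real \<Rightarrow> real \<Rightarrow> real^'r^'n \<Rightarrow> real" where
  "rho2 q\<^sub>1 q\<^sub>2 X =
     norm (neg_part X) powr q\<^sub>1 + norm (transpose X ** X - mat 1) powr q\<^sub>2"

end

theory Submission
  imports Defs
begin

text \<open>
  Write \<open>a = \<parallel>X\<^sub>-\<parallel>\<close>, \<open>b = \<parallel>X\<^sup>TX - I\<parallel>\<close> and \<open>S\<close> for the nonnegative Stiefel manifold.

  \<^emph>\<open>The square-root bound.\<close> If two columns of \<open>X\<close> are almost orthogonal and almost nonnegative,
  their positive parts have a small inner product, a sum of nonnegative terms; so in every row the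
  product of two positive parts is \<open>O(a + b)\<close>, and all entries of the row but the largest are
  \<open>O(sqrt (a + b))\<close>. Keeping only the positive part of the largest entry of each row makes the
  columns nonnegative with disjoint supports, and normalizing them gives a point of \<open>S\<close> at distance
  \<open>O(sqrt (a + b))\<close> (\<open>sqrt_error_bound_near_stiefel\<close>). This yields the local bounds when both
  exponents are at most \<open>1/2\<close>.

  \<^emph>\<open>Sharpness.\<close> A row of a point of \<open>S\<close> has at most one nonzero entry, so a matrix with two entries
  \<open>\<ge> c\<close> in one row has distance \<open>\<ge> c\<close> from \<open>S\<close>. Since \<open>r < n\<close>, there is a row \<open>l\<close> left over after
  placing \<open>r\<close> unit vectors, and adding \<open>t e\<^sub>l\<close> to two of them moves the matrix to distance
  \<open>\<ge> t\<close>. The inner product \<open>t\<^sup>2\<close> so created can either be left in the Gram matrix, which keeps \<open>a = 0\<close> and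
  makes \<open>b\<close> of order \<open>t\<^sup>2\<close>, or be cancelled by one negative entry \<open>-t\<^sup>2\<close>, which after normalization
  makes \<open>b = 0\<close> and \<open>a\<close> of order \<open>t\<^sup>2\<close> (\<open>gram_exponent_le_half\<close>, \<open>neg_part_exponent_le_half\<close>).

  \<^emph>\<open>Global behaviour.\<close> For \<open>Z \<in> S\<close> the distance of \<open>tZ\<close> from \<open>S\<close> grows like \<open>t\<close>, whereas \<open>b\<close>
  grows like \<open>t\<^sup>2\<close> and the singular values like \<open>t\<close>. Hence a global bound forces \<open>q\<^sub>2 \<ge> 1/2\<close> for
  \<open>\<rho>\<^sub>2\<close> and \<open>q\<^sub>2 \<ge> 1\<close> for \<open>\<rho>\<^sub>1\<close>; the latter contradicts the local requirement \<open>q\<^sub>2 \<le> 1/2\<close>. Conversely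
  \<open>\<parallel>X\<parallel>\<^sup>2 \<le> r (b + \<parallel>I\<parallel>)\<close>, so away from \<open>S\<close> the distance is bounded by a multiple of \<open>sqrt b\<close> when
  \<open>b\<close> is not small, and by a constant otherwise, where \<open>a\<close> is not small (\<open>global_error_bound_rho2_half\<close>).

  \<^emph>\<open>Singular values.\<close> To pass from \<open>\<rho>\<^sub>2\<close> to \<open>\<rho>\<^sub>1\<close>, diagonalize \<open>X\<^sup>TX\<close> orthogonally with eigenvalues
  \<open>d\<^sub>j \<ge> 0\<close>. Then \<open>b\<^sup>2\<close> is the sum of the \<open>(d\<^sub>j - 1)\<^sup>2\<close>, the singular values are the \<open>sqrt d\<^sub>j\<close>, and
  \<open>d - 1 = (sqrt d - 1) (sqrt d + 1)\<close> makes the two deviations equivalent near \<open>S\<close>.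
\<close>

text \<open>From here on \<open>$\<close> stands for vector indexing only.\<close>

unbundle no fps_syntax

section \<open>Orthogonal diagonalization of symmetric matrices\<close>

text \<open>
  The first-order condition at a maximum, for a quadratic in \<open>t\<close> with value \<open>0\<close> at \<open>t = 0\<close>.
\<close>

lemma linear_term_vanishes:
  fixes c k :: real
  assumes "\<And>t. 2 * t * c + t\<^sup>2 * k \<le> 0"
  shows "c = 0"
proof (rule ccontr)
  assume c: "c \<noteq> 0"
  \<comment> \<open>\<open>t\<close> has the sign of \<open>c\<close>, and the factor \<open>1 + \<bar>k\<bar>\<close> keeps the quadratic term smaller than the linear one\<close>
  define t where "t = c / (1 + \<bar>k\<bar>)"
  have p: "1 + \<bar>k\<bar> > 0" by simp
  have "2 * t * c + t\<^sup>2 * k = c\<^sup>2 / (1 + \<bar>k\<bar>)\<^sup>2 * (2 * (1 + \<bar>k\<bar>) + k)"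
  proof -
    have "c = t * (1 + \<bar>k\<bar>)" using p by (simp add: t_def)
    then have "2 * t * c + t\<^sup>2 * k = t\<^sup>2 * (2 * (1 + \<bar>k\<bar>) + k)"
      by (simp add: algebra_simps power2_eq_square)
    then show ?thesis by (simp add: t_def power_divide)
  qed
  moreover have "\<dots> > 0"
    using p c by (intro mult_pos_pos divide_pos_pos) auto
  ultimately show False using assms[of t] by simp
qed

text \<open>
  A maximizer \<open>v\<close> of the Rayleigh quotient on the unit sphere of \<open>V\<close>, with maximum \<open>M\<close>, is an
  eigenvector: moving from \<open>v\<close> in the direction of the residual \<open>w = f v - M v\<close>, which lies in \<open>V\<close>
  and is orthogonal to \<open>v\<close>, changes the quotient to first order by a multiple of \<open>w \<bullet> f v = w \<bullet> w\<close>,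
  so maximality forces \<open>w = 0\<close>.
\<close>

lemma selfadjoint_eigenvector_in_subspace:
  fixes f :: "'a::euclidean_space \<Rightarrow> 'a"
  assumes lin: "linear f" and sym: "\<And>x y. f x \<bullet> y = x \<bullet> f y"
    and V: "subspace V" "V \<noteq> {0}" and inv: "\<And>x. x \<in> V \<Longrightarrow> f x \<in> V"
  obtains v c where "v \<in> V" "norm v = 1" "f v = c *\<^sub>R v"
proof -
  interpret f: linear f by fact
  let ?K = "V \<inter> sphere 0 1"
  obtain u where u: "u \<in> V" "u \<noteq> 0"
    using V subspace_0 by blast
  have "u /\<^sub>R norm u \<in> ?K"
    using u V(1) by (simp add: subspace_scale)
  moreover have "compact ?K"
    using closed_subspace[OF V(1)] by (simp add: closed_Int_compact)
  moreover have "continuous_on ?K (\<lambda>x. x \<bullet> f x)"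
    by (intro continuous_intros linear_continuous_on linear_conv_bounded_linear[THEN iffD1] lin)
  ultimately obtain v where v: "v \<in> ?K" and max: "\<And>x. x \<in> ?K \<Longrightarrow> x \<bullet> f x \<le> v \<bullet> f v"
    using continuous_attains_sup[of ?K "\<lambda>x. x \<bullet> f x"] by blast
  define M where "M = v \<bullet> f v"
  have vv: "v \<bullet> v = 1" using v by (simp add: dot_square_norm)
  have rayleigh: "x \<bullet> f x \<le> M * (x \<bullet> x)" if "x \<in> V" for x
  proof (cases "x = 0")
    case False
    have "(x /\<^sub>R norm x) \<bullet> f (x /\<^sub>R norm x) \<le> M"
      unfolding M_def using that False V(1) by (intro max) (simp add: subspace_scale)
    then have "(x \<bullet> f x) / (norm x)\<^sup>2 \<le> M"
      by (simp add: f.scale power2_eq_square divide_inverse mult_ac)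
    then show ?thesis
      using False by (simp add: divide_le_eq dot_square_norm)
  qed (simp add: f.zero)
  define w where "w = f v - M *\<^sub>R v"
  have wV: "w \<in> V" unfolding w_def
    using v V(1) inv by (intro subspace_diff subspace_scale) auto
  have vw: "v \<bullet> w = 0" by (simp add: w_def inner_diff_right M_def vv)
  have "2 * t * (w \<bullet> f v) + t\<^sup>2 * (w \<bullet> f w - M * (w \<bullet> w)) \<le> 0" for t
  proof -
    have "v + t *\<^sub>R w \<in> V" using v wV V(1) by (simp add: subspace_add subspace_scale)
    from rayleigh[OF this] show ?thesis
      using vw vv sym[of v w]
      by (simp add: f.add f.scale inner_add_left inner_add_right M_def[symmetric] algebra_simps
          power2_eq_square inner_commute)
  qed
  then have "w \<bullet> f v = 0" by (rule linear_term_vanishes)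
  moreover have "w \<bullet> f v = w \<bullet> w"
    using vw by (simp add: w_def inner_diff_right inner_diff_left inner_commute algebra_simps)
  ultimately have "f v = M *\<^sub>R v" by (simp add: w_def)
  with that v show thesis by auto
qed

text \<open>
  Take an orthonormal set \<open>B\<close> of eigenvectors of maximal cardinality. Its orthogonal complement is
  invariant by self-adjointness; if it were nonzero it would contain another eigenvector, which
  could be added to \<open>B\<close>.
\<close>

lemma selfadjoint_orthonormal_eigenbasis:
  fixes f :: "'a::euclidean_space \<Rightarrow> 'a"
  assumes lin: "linear f" and sym: "\<And>x y. f x \<bullet> y = x \<bullet> f y"
  obtains B where "finite B" "card B = DIM('a)" "pairwise orthogonal B"
    "\<And>b. b \<in> B \<Longrightarrow> norm b = 1" "\<And>b. b \<in> B \<Longrightarrow> \<exists>c. f b = c *\<^sub>R b"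
proof -
  define P where "P B \<longleftrightarrow> pairwise orthogonal B \<and> (\<forall>b\<in>B. norm b = 1 \<and> (\<exists>c. f b = c *\<^sub>R b))"
    for B
  have indep: "independent B" if "P B" for B
    using that unfolding P_def by (intro pairwise_orthogonal_independent) auto
  then have bound: "card B \<le> DIM('a)" if "P B" for B
    using that independent_bound by blast
  have "P {}" by (simp add: P_def)
  then obtain B where B: "P B" and maxB: "\<And>C. P C \<Longrightarrow> card C \<le> card B"
    using ex_has_greatest_nat[of P "{}" card "DIM('a) + 1"] bound by (metis less_Suc_eq_le Suc_eq_plus1)
  have fin: "finite B" using indep[OF B] independent_bound by blast
  define V where "V = {y. \<forall>b\<in>B. orthogonal b y}"
  have V: "subspace V" unfolding V_def by (rule subspace_orthogonal_to_vectors)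
  have inv: "f x \<in> V" if "x \<in> V" for x
    unfolding V_def orthogonal_def
  proof safe
    fix b assume b: "b \<in> B"
    then obtain c where "f b = c *\<^sub>R b" using B by (auto simp: P_def)
    then show "b \<bullet> f x = 0"
      using that b sym[of b x] by (simp add: V_def orthogonal_def)
  qed
  have "V = {0}"
  proof (rule ccontr)
    assume "V \<noteq> {0}"
    then obtain v c where v: "v \<in> V" "norm v = 1" "f v = c *\<^sub>R v"
      using selfadjoint_eigenvector_in_subspace[OF lin sym V _ inv] by blast
    have "v \<notin> B" using v by (auto simp: V_def orthogonal_def)
    moreover have "P (insert v B)"
      using B v by (auto simp: P_def V_def pairwise_insert orthogonal_commute)
    ultimately show False using maxB[of "insert v B"] fin by simp
  qed
  have "card B = DIM('a)"
  proof (rule ccontr)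
    assume "card B \<noteq> DIM('a)"
    then have "dim (span B) < DIM('a)"
      using bound[OF B] dim_eq_card_independent[OF indep[OF B]] by simp
    then obtain x where "x \<noteq> 0" "\<And>y. y \<in> span (span B) \<Longrightarrow> orthogonal x y"
      by (metis dim_span orthogonal_to_subspace_exists)
    then have "x \<in> V" "x \<noteq> 0"
      by (auto simp: V_def orthogonal_commute span_base)
    with \<open>V = {0}\<close> show False by simp
  qed
  with that fin B show thesis by (auto simp: P_def)
qed

lemma symmetric_matrix_diagonalization:
  fixes A :: "real^'r^'r"
  assumes "transpose A = A"
  obtains Q :: "real^'r^'r" and d where "orthogonal_matrix Q"
    "\<And>j. A *v column j Q = d j *\<^sub>R column j Q"
proof -
  have sym: "(A *v x) \<bullet> y = x \<bullet> (A *v y)" for x y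
    using assms dot_lmul_matrix[of x A y] by (metis transpose_matrix_vector)
  obtain B where B: "finite B" "card B = DIM(real^'r)" "pairwise orthogonal B"
    "\<And>b. b \<in> B \<Longrightarrow> norm b = 1" "\<And>b. b \<in> B \<Longrightarrow> \<exists>c. A *v b = c *\<^sub>R b"
    using selfadjoint_orthonormal_eigenbasis[of "(*v) A", OF matrix_vector_mul_linear sym] by metis
  then obtain h where h: "bij_betw h (UNIV :: 'r set) B"
    using finite_same_card_bij[of "UNIV :: 'r set" B] by auto
  define Q :: "real^'r^'r" where "Q = (\<chi> i j. h j $ i)"
  have col: "column j Q = h j" for j by (simp add: Q_def column_def vec_eq_iff)
  have "h j \<in> B" for j using h by (auto simp: bij_betw_def)
  moreover have "h i \<noteq> h j" if "i \<noteq> j" for i j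
    using h that by (auto simp: bij_betw_def inj_on_def)
  ultimately have "orthogonal_matrix Q"
    unfolding orthogonal_matrix_orthonormal_columns col using B by (auto simp: pairwise_def)
  moreover have "\<exists>d. \<forall>j. A *v h j = d j *\<^sub>R h j"
    using B(5) \<open>\<And>j. h j \<in> B\<close> by (intro choice) blast
  ultimately show thesis using that by (metis col)
qed

lemma poly_charpoly: "poly (charpoly A) x = det (mat x - A)" for A :: "real^'r^'r"
proof -
  have entry: "poly ((if i = j then [:0, 1:] else 0) - [:A $ i $ j:]) x = (mat x - A) $ i $ j" for i j
    by (simp add: mat_def)
  have "poly (charpoly A) x = (\<Sum>p | p permutes UNIV. of_int (sign p) *
      (\<Prod>i\<in>UNIV. poly ((if i = p i then [:0, 1:] else 0) - [:A $ i $ p i:]) x))"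
    by (simp only: charpoly_def det_def poly_sum poly_mult poly_prod of_int_poly poly_const_conv vec_lambda_beta poly_pCons poly_0 mult_zero_right add_0_right)
  also have "\<dots> = det (mat x - A)"
    by (simp only: entry det_def)
  finally show ?thesis .
qed

text \<open>
  Over an infinite field a polynomial is determined by its values, and the value of the
  characteristic polynomial at \<open>x\<close> is the determinant of a real matrix, to which
  multiplicativity applies. The norm identity holds because right multiplication by \<open>Q\<close> preserves the
  length of every row, and turns \<open>A - I\<close> into the matrix with columns \<open>(d\<^sub>j - 1) q\<^sub>j\<close>.
\<close>

lemma charpoly_and_norm_of_diagonalization:
  fixes A Q :: "real^'r^'r"
  assumes Q: "orthogonal_matrix Q" and AQ: "\<And>j. A *v column j Q = d j *\<^sub>R column j Q"
  shows "charpoly A = (\<Prod>j\<in>UNIV. [:- d j, 1:])"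
    and "(norm (A - mat 1))\<^sup>2 = (\<Sum>j\<in>UNIV. (d j - 1)\<^sup>2)"
proof -
  have col: "column j (M ** Q) = M *v column j Q" for M :: "real^'r^'r" and j
    by (simp add: vec_eq_iff column_def matrix_matrix_mult_def matrix_vector_mult_def)
  have "poly (charpoly A) x = poly (\<Prod>j\<in>UNIV. [:- d j, 1:]) x" for x
  proof -
    have "(mat x - A) ** Q = Q ** (\<chi> i j. if i = j then x - d j else 0)"
    proof -
      have "column j ((mat x - A) ** Q) = column j (Q ** (\<chi> i j. if i = j then x - d j else 0))" for j
      proof -
        have "column j ((mat x - A) ** Q) = x *\<^sub>R column j Q - d j *\<^sub>R column j Q"
          unfolding col AQ[symmetric] matrix_vector_mult_diff_rdistrib
          by (simp add: vec_eq_iff matrix_vector_mult_def mat_def if_distrib[of "\<lambda>a. a * _"] cong: if_cong)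
        also have "\<dots> = column j (Q ** (\<chi> i j. if i = j then x - d j else 0))"
          by (simp add: vec_eq_iff column_def matrix_matrix_mult_def algebra_simps
              if_distrib[of "\<lambda>a. _ * a"] cong: if_cong)
        finally show ?thesis .
      qed
      then show ?thesis by (simp add: vec_eq_iff column_def)
    qed
    then have "det (mat x - A) * det Q = det Q * (\<Prod>j\<in>UNIV. x - d j)"
      using det_mul[of "mat x - A" Q] det_mul[of Q "\<chi> i j. if i = j then x - d j else 0"]
        det_diagonal[of "\<chi> i j. if i = j then x - d j else 0"] by auto
    moreover have "det Q \<noteq> 0" using det_orthogonal_matrix[OF Q] by auto
    ultimately show ?thesis by (simp add: poly_charpoly poly_prod)
  qed
  then show "charpoly A = (\<Prod>j\<in>UNIV. [:- d j, 1:])" by (simp add: poly_eq_poly_eq_iff[symmetric] fun_eq_iff)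
  let ?M = "A - mat 1"
  have nQ: "norm (v v* Q) = norm v" for v
  proof -
    have "(v v* Q) \<bullet> (v v* Q) = v \<bullet> ((Q ** transpose Q) *v v)"
      by (simp add: dot_lmul_matrix matrix_vector_mul_assoc[symmetric])
    then show ?thesis using Q by (simp add: orthogonal_matrix_def norm_eq_sqrt_inner)
  qed
  have rows: "(?M ** Q) $ i = ?M $ i v* Q" for i
    by (simp add: vec_eq_iff matrix_matrix_mult_def vector_matrix_mult_def mult.commute)
  have "(norm ?M)\<^sup>2 = (\<Sum>i\<in>UNIV. (norm (?M $ i))\<^sup>2)"
    by (simp add: dot_square_norm[symmetric] inner_vec_def)
  also have "\<dots> = (\<Sum>i\<in>UNIV. (norm ((?M ** Q) $ i))\<^sup>2)"
    by (simp add: rows nQ)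
  also have "\<dots> = (\<Sum>j\<in>UNIV. (norm (column j (?M ** Q)))\<^sup>2)"
    unfolding dot_square_norm[symmetric] inner_vec_def column_def
    by (simp, rule sum.swap)
  also have "\<dots> = (\<Sum>j\<in>UNIV. (d j - 1)\<^sup>2)"
  proof (intro sum.cong refl)
    fix j
    have "column j (?M ** Q) = (d j - 1) *\<^sub>R column j Q"
      unfolding col by (simp add: matrix_vector_mult_diff_rdistrib AQ algebra_simps)
    moreover have "norm (column j Q) = 1"
      using Q by (simp add: orthogonal_matrix_orthonormal_columns)
    ultimately show "(norm (column j (?M ** Q)))\<^sup>2 = (d j - 1)\<^sup>2" by simp
  qed
  finally show "(norm ?M)\<^sup>2 = (\<Sum>j\<in>UNIV. (d j - 1)\<^sup>2)" .
qed

section \<open>Singular values and the Gram matrix\<close>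

definition singular_value_deviation :: "real^'r^'n \<Rightarrow> real" where
  "singular_value_deviation X = L2_set (\<lambda>i. singular_values X ! i - 1) {..<CARD('r)}"

text \<open>
  Both error terms are expressed through the same eigenvalues of \<open>X\<^sup>TX\<close>, which makes them
  comparable term by term. The second identity is obtained from the multiset of the listed values,
  since a sum over a list is a sum over its multiset.
\<close>

lemma singular_values_gram:
  fixes X :: "real^'r^'n"
  obtains d :: "'r \<Rightarrow> real" where "\<And>j. 0 \<le> d j"
    "(norm (transpose X ** X - mat 1))\<^sup>2 = (\<Sum>j\<in>UNIV. (d j - 1)\<^sup>2)"
    "(singular_value_deviation X)\<^sup>2 = (\<Sum>j\<in>UNIV. (sqrt (d j) - 1)\<^sup>2)"
proof -
  let ?A = "transpose X ** X"
  have "transpose ?A = ?A" by (simp add: matrix_transpose_mul)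
  then obtain Q d where Q: "orthogonal_matrix Q"
    and AQ: "\<And>j. ?A *v column j Q = d j *\<^sub>R column j Q"
    using symmetric_matrix_diagonalization by blast
  note cp = charpoly_and_norm_of_diagonalization[OF Q AQ]
  have "0 \<le> d j" for j
  proof -
    have "d j = column j Q \<bullet> (?A *v column j Q)"
      using Q unfolding AQ by (simp add: orthogonal_matrix_orthonormal_columns dot_square_norm)
    also have "\<dots> = (X *v column j Q) \<bullet> (X *v column j Q)"
      by (simp add: matrix_vector_mul_assoc[symmetric] dot_lmul_matrix[symmetric] inner_commute)
    finally show ?thesis by simp
  qed
  moreover have "(singular_value_deviation X)\<^sup>2
     = (\<Sum>j\<in>UNIV. (sqrt (d j) - 1)\<^sup>2)"
  proof -
    let ?l = "singular_values X"
    have "(\<Sum>j\<in>UNIV. {#d j#}) = image_mset d (mset_set UNIV)"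
      by (simp add: sum_unfold_sum_mset)
    then have m: "mset ?l = image_mset (\<lambda>j. sqrt (d j)) (mset_set UNIV)"
      by (simp add: singular_values_def cp(1) proots_prod image_mset.compositionality comp_def)
    have "length ?l = CARD('r)" using arg_cong[OF m, of size] by simp
    then have "(\<Sum>i<CARD('r). (?l ! i - 1)\<^sup>2) = (\<Sum>x\<leftarrow>?l. (x - 1)\<^sup>2)"
      by (simp add: sum_list_sum_nth atLeast0LessThan)
    also have "\<dots> = sum_mset (image_mset (\<lambda>x. (x - 1)\<^sup>2) (mset ?l))"
      by (metis mset_map sum_mset_sum_list)
    also have "\<dots> = (\<Sum>j\<in>UNIV. (sqrt (d j) - 1)\<^sup>2)"
      by (simp add: m image_mset.compositionality comp_def sum_unfold_sum_mset)
    finally show ?thesis by (simp add: singular_value_deviation_def L2_set_def sum_nonneg)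
  qed
  ultimately show thesis using that cp(2) by blast
qed

lemma singular_value_deviation_nonneg: "0 \<le> singular_value_deviation X"
  by (simp add: singular_value_deviation_def L2_set_nonneg)

lemma sqrt_minus_one_factor: "0 \<le> d \<Longrightarrow> \<bar>d - 1\<bar> = \<bar>sqrt d - 1\<bar> * (sqrt d + 1)"
proof -
  assume "0 \<le> d"
  then have "d - 1 = (sqrt d - 1) * (sqrt d + 1)" by (simp add: algebra_simps)
  then show ?thesis using \<open>0 \<le> d\<close> by (simp add: abs_mult)
qed

lemma singular_value_deviation_le_gram:
  fixes X :: "real^'r^'n"
  shows "singular_value_deviation X \<le> norm (transpose X ** X - mat 1)"
proof -
  obtain d :: "'r \<Rightarrow> real" where d: "\<And>j. 0 \<le> d j"
    "(norm (transpose X ** X - mat 1))\<^sup>2 = (\<Sum>j\<in>UNIV. (d j - 1)\<^sup>2)"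
    "(singular_value_deviation X)\<^sup>2 = (\<Sum>j\<in>UNIV. (sqrt (d j) - 1)\<^sup>2)"
    using singular_values_gram[of X] by blast
  have "(sqrt (d j) - 1)\<^sup>2 \<le> (d j - 1)\<^sup>2" for j
    using d(1)[of j] mult_left_mono[of 1 "sqrt (d j) + 1" "\<bar>sqrt (d j) - 1\<bar>"]
    by (intro abs_le_square_iff[THEN iffD1]) (simp add: sqrt_minus_one_factor[OF d(1)])
  then have "(singular_value_deviation X)\<^sup>2 \<le> (norm (transpose X ** X - mat 1))\<^sup>2"
    unfolding d by (rule sum_mono)
  then show ?thesis by (rule power2_le_imp_le) simp
qed

text \<open>
  Unlike the preceding estimate this one is quadratic on the left: it gives the right growth for
  large matrices, from \<open>(sqrt d - 1)\<^sup>2 \<le> \<bar>sqrt d - 1\<bar> (sqrt d + 1) = \<bar>d - 1\<bar>\<close>.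
\<close>

lemma singular_value_deviation_sq_le_gram:
  fixes X :: "real^'r^'n"
  shows "(singular_value_deviation X)\<^sup>2 \<le> CARD('r) * norm (transpose X ** X - mat 1)"
proof -
  let ?g = "norm (transpose X ** X - mat 1)"
  obtain d :: "'r \<Rightarrow> real" where d: "\<And>j. 0 \<le> d j"
    "?g\<^sup>2 = (\<Sum>j\<in>UNIV. (d j - 1)\<^sup>2)"
    "(singular_value_deviation X)\<^sup>2 = (\<Sum>j\<in>UNIV. (sqrt (d j) - 1)\<^sup>2)"
    using singular_values_gram[of X] by blast
  have "(sqrt (d j) - 1)\<^sup>2 \<le> ?g" for j
  proof -
    have "(sqrt (d j) - 1)\<^sup>2 = \<bar>sqrt (d j) - 1\<bar> * \<bar>sqrt (d j) - 1\<bar>"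
      by (simp add: power2_eq_square)
    also have "\<dots> \<le> \<bar>sqrt (d j) - 1\<bar> * (sqrt (d j) + 1)"
    proof (rule mult_left_mono)
      show "\<bar>sqrt (d j) - 1\<bar> \<le> sqrt (d j) + 1"
        using real_sqrt_ge_zero[OF d(1)[of j]] by linarith
    qed simp
    also have "\<dots> = \<bar>d j - 1\<bar>" using d(1) by (simp add: sqrt_minus_one_factor[OF d(1)])
    also have "\<dots> \<le> ?g"
      by (rule power2_le_imp_le)
         (use d(2) member_le_sum[of j UNIV "\<lambda>j. (d j - 1)\<^sup>2"] in auto)
    finally show ?thesis .
  qed
  then have "(\<Sum>j\<in>UNIV. (sqrt (d j) - 1)\<^sup>2) \<le> (\<Sum>j\<in>(UNIV :: 'r set). ?g)"
    by (intro sum_mono)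
  then show ?thesis by (simp add: d(3))
qed

text \<open>
  Under the hypothesis every eigenvalue is at most \<open>2\<close>, so the factor \<open>sqrt d + 1\<close> relating the two
  deviations is at most \<open>3\<close>.
\<close>

lemma gram_le_singular_value_deviation:
  fixes X :: "real^'r^'n"
  assumes "norm (transpose X ** X - mat 1) \<le> 1"
  shows "norm (transpose X ** X - mat 1) \<le> 3 * singular_value_deviation X"
proof -
  let ?g = "norm (transpose X ** X - mat 1)"
  obtain d :: "'r \<Rightarrow> real" where d: "\<And>j. 0 \<le> d j"
    "?g\<^sup>2 = (\<Sum>j\<in>UNIV. (d j - 1)\<^sup>2)"
    "(singular_value_deviation X)\<^sup>2 = (\<Sum>j\<in>UNIV. (sqrt (d j) - 1)\<^sup>2)"
    using singular_values_gram[of X] by blast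
  have "(d j - 1)\<^sup>2 \<le> (3 * (sqrt (d j) - 1))\<^sup>2" for j
  proof -
    have "\<bar>d j - 1\<bar> \<le> ?g"
      by (rule power2_le_imp_le)
         (use d(2) member_le_sum[of j UNIV "\<lambda>j. (d j - 1)\<^sup>2"] in auto)
    with assms have "d j \<le> 2\<^sup>2" by simp
    then have "sqrt (d j) \<le> 2" by (rule real_le_lsqrt[rotated]) simp
    then have "\<bar>sqrt (d j) - 1\<bar> * (sqrt (d j) + 1) \<le> \<bar>sqrt (d j) - 1\<bar> * 3"
      by (intro mult_left_mono) auto
    then show ?thesis
      using d(1) by (intro abs_le_square_iff[THEN iffD1]) (simp add: sqrt_minus_one_factor[OF d(1)] abs_mult mult.commute del: right_diff_distrib_numeral)
  qed
  then have "?g\<^sup>2 \<le> (\<Sum>j\<in>UNIV. (3 * (sqrt (d j) - 1))\<^sup>2)"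
    unfolding d by (rule sum_mono)
  also have "\<dots> = (3 * singular_value_deviation X)\<^sup>2"
    by (simp add: power_mult_distrib d(3) sum_distrib_left del: right_diff_distrib_numeral)
  finally show ?thesis
    by (rule power2_le_imp_le) (simp add: singular_value_deviation_nonneg)
qed

section \<open>Entries, norms and the Gram matrix\<close>

lemma entry_le_norm: "\<bar>X $ i $ j\<bar> \<le> norm X" for X :: "real^'r^'n"
  using component_le_norm_cart[of "X $ i" j] Finite_Cartesian_Product.norm_nth_le[of X i] by simp

lemma norm_le_of_entries_le:
  fixes X :: "real^'r^'n"
  assumes "\<And>i j. \<bar>X $ i $ j\<bar> \<le> c"
  shows "norm X \<le> real (CARD('n) * CARD('r)) * c"
proof -
  have "norm X \<le> (\<Sum>i\<in>UNIV. norm (X $ i))"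
    unfolding norm_vec_def by (rule L2_set_le_sum) simp
  also have "\<dots> \<le> (\<Sum>i\<in>(UNIV :: 'n set). CARD('r) * c)"
  proof (rule sum_mono)
    fix i
    have "norm (X $ i) \<le> (\<Sum>j\<in>UNIV. \<bar>X $ i $ j\<bar>)" by (rule norm_le_l1_cart)
    also have "\<dots> \<le> (\<Sum>j\<in>(UNIV :: 'r set). c)" using assms by (intro sum_mono)
    finally show "norm (X $ i) \<le> CARD('r) * c" by simp
  qed
  finally show ?thesis by simp
qed

lemma gram_entry: "(transpose X ** X) $ j $ k = (\<Sum>i\<in>UNIV. X $ i $ j * X $ i $ k)"
  for X :: "real^'r^'n"
  by (simp add: matrix_matrix_mult_def transpose_def)

lemma norm_sq_eq_trace_gram:
  fixes X :: "real^'r^'n"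
  shows "(norm X)\<^sup>2 = (\<Sum>j\<in>UNIV. (transpose X ** X) $ j $ j)"
proof -
  have "(norm X)\<^sup>2 = (\<Sum>i\<in>UNIV. \<Sum>j\<in>UNIV. X $ i $ j * X $ i $ j)"
    by (simp add: dot_square_norm[symmetric] inner_vec_def)
  also have "\<dots> = (\<Sum>j\<in>UNIV. (transpose X ** X) $ j $ j)"
    unfolding gram_entry by (rule sum.swap)
  finally show ?thesis .
qed

lemma norm_neg_part_entry: "max (- (X $ i $ j)) 0 \<le> norm (neg_part X)"
  using entry_le_norm[of "neg_part X" i j] by (simp add: neg_part_def)

lemma gram_defect_entry:
  "abs ((\<Sum>i\<in>UNIV. X $ i $ j * X $ i $ k) - (if j = k then 1 else 0))
     \<le> norm (transpose X ** X - mat 1)"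
  for X :: "real^'r^'n"
  using entry_le_norm[of "transpose X ** X - mat 1" j k] by (simp add: gram_entry mat_def)

lemma nonneg_stiefelI:
  fixes X :: "real^'r^'n"
  assumes "\<And>j k. (\<Sum>i\<in>UNIV. X $ i $ j * X $ i $ k) = (if j = k then 1 else 0)"
    and "\<And>i j. 0 \<le> X $ i $ j"
  shows "X \<in> nonneg_stiefel"
  using assms by (simp add: nonneg_stiefel_def vec_eq_iff gram_entry mat_def)

section \<open>The square-root bound near the manifold\<close>

text \<open>
  Replacing the columns by their positive parts changes each summand of their inner product by at
  most \<open>5a\<close> with \<open>a = \<parallel>X\<^sub>-\<parallel>\<close>, because entries are bounded by \<open>2\<close> and negative parts by \<open>a \<le> 1\<close>.
  The inner product itself is at most \<open>d\<close>, whence the constant \<open>6 n\<close>; as its summands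
  have become nonnegative, each of them obeys the same bound.
\<close>

lemma positive_parts_almost_orthogonal:
  fixes X :: "real^'r^'n" and d :: real
  assumes d: "norm (neg_part X) + norm (transpose X ** X - mat 1) \<le> d" "d \<le> 1" and "j \<noteq> k"
  shows "max (X $ i $ j) 0 * max (X $ i $ k) 0 \<le> 6 * CARD('n) * d"
proof -
  define a b where "a = norm (neg_part X)" and "b = norm (transpose X ** X - mat 1)"
  have ab: "0 \<le> a" "0 \<le> b" "a + b \<le> d" "a \<le> 1" "b \<le> 1"
    using d norm_ge_zero[of "neg_part X"] norm_ge_zero[of "transpose X ** X - mat 1"]
    unfolding a_def b_def by linarith+
  have bound: "\<bar>X $ l $ m\<bar> \<le> 2" for l m
  proof -
    have "(X $ l $ m)\<^sup>2 \<le> (\<Sum>i\<in>UNIV. X $ i $ m * X $ i $ m)"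
      using member_le_sum[of l UNIV "\<lambda>i. X $ i $ m * X $ i $ m"] by (simp add: power2_eq_square)
    also have "\<dots> \<le> 2" using gram_defect_entry[of X m m] ab by (simp add: b_def)
    finally have "\<bar>X $ l $ m\<bar>\<^sup>2 \<le> 2\<^sup>2" by simp
    then show ?thesis by (rule power2_le_imp_le) simp
  qed
  have term_le: "max (X $ l $ j) 0 * max (X $ l $ k) 0 \<le> X $ l $ j * X $ l $ k + 5 * a" for l
  proof -
    define x y u v where "x = X $ l $ j" and "y = X $ l $ k"
      and "u = max (- x) 0" and "v = max (- y) 0"
    have u: "0 \<le> u" "u \<le> a" "0 \<le> v" "v \<le> a"
      using norm_neg_part_entry[of X l j] norm_neg_part_entry[of X l k]
      by (auto simp: u_def v_def x_def y_def a_def)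
    have "max x 0 = x + u" "max y 0 = y + v" by (auto simp: u_def v_def)
    then have "max x 0 * max y 0 = x * y + (x * v + u * y + u * v)"
      by (simp add: algebra_simps)
    moreover have "x * v \<le> 2 * a"
      using mult_mono[of "\<bar>x\<bar>" 2 v a] bound[of l j] u abs_le_iff[of "x * v" "2 * a"]
      by (simp add: x_def abs_mult)
    moreover have "u * y \<le> a * 2"
      using mult_mono[of u a "\<bar>y\<bar>" 2] bound[of l k] u abs_le_iff[of "u * y" "a * 2"]
      by (simp add: y_def abs_mult)
    moreover have "u * v \<le> a * 1"
      using u ab by (intro mult_mono) auto
    ultimately show ?thesis by (simp add: x_def y_def)
  qed
  have "max (X $ i $ j) 0 * max (X $ i $ k) 0 \<le> (\<Sum>l\<in>UNIV. max (X $ l $ j) 0 * max (X $ l $ k) 0)"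
    using member_le_sum[of i UNIV "\<lambda>l. max (X $ l $ j) 0 * max (X $ l $ k) 0"] by simp
  also have "\<dots> \<le> (\<Sum>l\<in>UNIV. X $ l $ j * X $ l $ k + 5 * a)" by (rule sum_mono) (rule term_le)
  also have "\<dots> = (\<Sum>l\<in>UNIV. X $ l $ j * X $ l $ k) + 5 * (CARD('n) * a)"
    by (simp add: sum.distrib)
  also have "\<dots> \<le> b + 5 * (CARD('n) * a)"
    using gram_defect_entry[of X j k] \<open>j \<noteq> k\<close> by (simp add: b_def)
  also have "\<dots> \<le> 6 * (CARD('n) * d)"
  proof -
    have "b \<le> d" "a \<le> d" using ab by auto
    moreover have "d \<le> CARD('n) * d" using ab mult_right_mono[of 1 "real CARD('n)" d] by simp
    moreover have "CARD('n) * a \<le> CARD('n) * d" using \<open>a \<le> d\<close> by (simp add: mult_left_mono)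
    ultimately show ?thesis by linarith
  qed
  finally show ?thesis by simp
qed

text \<open>
  The point of the manifold is built from \<open>X\<close> by keeping, in each row, only the positive part of
  the largest entry, and then normalizing the columns. The first step moves entries by at most
  \<open>s = sqrt (6 n d)\<close>: the square of a discarded positive entry is at most its product with the
  retained one. The second moves them by at most \<open>2e\<close>, since the column norms differ from \<open>1\<close> by at
  most \<open>2e\<close>; they are nonzero as \<open>e \<le> 1/4\<close>.
\<close>

lemma nearby_stiefel_matrix:
  fixes X :: "real^'r^'n" and d e :: real
  defines "m \<equiv> real (CARD('n) * CARD('r))"
  assumes d: "norm (neg_part X) + norm (transpose X ** X - mat 1) = d"
    and e: "e = m * sqrt (6 * CARD('n) * d)" "e \<le> 1 / 4" and "d \<le> 1"
  shows "infdist X nonneg_stiefel \<le> 3 * m * e"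
proof -
  have d0: "0 \<le> d" using d by (metis add_nonneg_nonneg norm_ge_zero)
  have gram_d: "norm (transpose X ** X - mat 1) \<le> d"
    using d norm_ge_zero[of "neg_part X"] by linarith
  have m1: "1 \<le> m" unfolding m_def by (simp del: of_nat_mult add: Suc_leI)
  define s where "s = sqrt (6 * CARD('n) * d)"
  have s0: "0 \<le> s" using d0 by (simp add: s_def)
  have se: "s \<le> e" "0 \<le> e" using m1 s0 mult_right_mono[of 1 m s] by (auto simp: e s_def)
  have ds: "d \<le> s"
  proof -
    have "d * d \<le> 1 * d" using d0 \<open>d \<le> 1\<close> by (intro mult_right_mono)
    also have "\<dots> \<le> 6 * CARD('n) * d"
    proof (rule mult_right_mono)
      have "1 \<le> 6 * CARD('n)" by (simp add: Suc_leI)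
      then show "1 \<le> real (6 * CARD('n))" by (simp only: real_of_nat_ge_one_iff)
    qed (rule d0)
    finally show ?thesis unfolding s_def by (intro real_le_rsqrt) (simp add: power2_eq_square)
  qed
  have neg: "- (X $ i $ j) \<le> s" for i j
    using norm_neg_part_entry[of X i j] d ds norm_ge_zero[of "transpose X ** X - mat 1"] by linarith
  have "\<exists>k. \<forall>j. X $ i $ j \<le> X $ i $ k" for i
  proof -
    let ?R = "range (\<lambda>j. X $ i $ j)"
    have "Max ?R \<in> ?R" by (rule Max_in) auto
    then obtain k where k: "Max ?R = X $ i $ k" by blast
    have "X $ i $ j \<le> Max ?R" for j by (rule Max_ge) auto
    with k show ?thesis by auto
  qed
  then obtain f where f: "\<And>i j. X $ i $ j \<le> X $ i $ f i" by metis
  have small: "max (X $ i $ j) 0 \<le> s" if "j \<noteq> f i" for i j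
  proof -
    have "(max (X $ i $ j) 0)\<^sup>2 \<le> max (X $ i $ j) 0 * max (X $ i $ f i) 0"
      unfolding power2_eq_square using f[of i j] by (intro mult_left_mono) auto
    also have "\<dots> \<le> 6 * CARD('n) * d"
      using d \<open>d \<le> 1\<close> that by (intro positive_parts_almost_orthogonal) auto
    finally show ?thesis unfolding s_def by (rule real_le_rsqrt)
  qed
  define Y :: "real^'r^'n" where "Y = (\<chi> i j. if j = f i then max (X $ i $ j) 0 else 0)"
  have XY: "\<bar>X $ i $ j - Y $ i $ j\<bar> \<le> s" for i j
    using neg[of i j] small[of j i] s0 by (auto simp: Y_def max_def split: if_splits)
  define c where "c j = column j Y" for j
  have Yc: "Y $ i $ j = c j $ i" for i j by (simp add: c_def column_def)
  have c_inner: "c j \<bullet> c k = 0" if "j \<noteq> k" for j k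
    using that by (auto simp: inner_vec_def c_def column_def Y_def intro!: sum.neutral)
  have c_norm: "\<bar>norm (c j) - 1\<bar> \<le> 2 * e" for j
  proof -
    have "norm (column j X - c j) \<le> (\<Sum>i\<in>UNIV. \<bar>(column j X - c j) $ i\<bar>)"
      by (rule norm_le_l1_cart)
    also have "\<dots> \<le> (\<Sum>i\<in>(UNIV :: 'n set). s)"
      using XY by (intro sum_mono) (simp add: c_def column_def)
    also have "\<dots> \<le> e"
    proof -
      have "CARD('n) * s \<le> m * s" unfolding m_def
        using s0 by (intro mult_right_mono) (auto simp: Suc_leI)
      then show ?thesis by (simp add: e s_def)
    qed
    finally have "norm (column j X - c j) \<le> e" .
    moreover have "\<bar>norm (column j X) - 1\<bar> \<le> e"
    proof -
      let ?n = "norm (column j X)"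
      have "?n\<^sup>2 = (\<Sum>i\<in>UNIV. X $ i $ j * X $ i $ j)"
        by (simp add: dot_square_norm[symmetric] inner_vec_def column_def)
      then have "\<bar>?n\<^sup>2 - 1\<bar> \<le> d"
        using gram_defect_entry[of X j j] gram_d by simp
      moreover have "\<bar>?n - 1\<bar> \<le> \<bar>?n\<^sup>2 - 1\<bar>"
      proof -
        have "?n\<^sup>2 - 1 = (?n - 1) * (?n + 1)" by (simp add: power2_eq_square algebra_simps)
        then have "\<bar>?n\<^sup>2 - 1\<bar> = \<bar>?n - 1\<bar> * (?n + 1)" by (simp add: abs_mult)
        moreover have "\<bar>?n - 1\<bar> * 1 \<le> \<bar>?n - 1\<bar> * (?n + 1)"
          by (intro mult_left_mono) auto
        ultimately show ?thesis by (simp only: mult_1_right)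
      qed
      ultimately show ?thesis using ds se by linarith
    qed
    moreover have "\<bar>norm (column j X) - norm (c j)\<bar> \<le> norm (column j X - c j)"
      by (rule norm_triangle_ineq3)
    ultimately show ?thesis by linarith
  qed
  have c_pos: "norm (c j) > 0" for j using c_norm[of j] e(2) by linarith
  define Z :: "real^'r^'n" where "Z = (\<chi> i j. c j $ i / norm (c j))"
  have "Z \<in> nonneg_stiefel"
  proof (rule nonneg_stiefelI)
    fix j k
    have "(\<Sum>i\<in>UNIV. Z $ i $ j * Z $ i $ k) = (c j \<bullet> c k) / (norm (c j) * norm (c k))"
      by (simp add: Z_def inner_vec_def sum_divide_distrib)
    also have "\<dots> = (if j = k then 1 else 0)"
      using c_inner[of j k] c_pos[of j] by (auto simp: dot_square_norm power2_eq_square)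
    finally show "(\<Sum>i\<in>UNIV. Z $ i $ j * Z $ i $ k) = (if j = k then 1 else 0)" .
  next
    show "0 \<le> Z $ i $ j" for i j
      by (simp add: Z_def Yc[symmetric]) (simp add: Y_def)
  qed
  then have "infdist X nonneg_stiefel \<le> norm (X - Z)"
    using infdist_le[of Z nonneg_stiefel X] by (simp add: dist_norm)
  also have "\<dots> \<le> m * (3 * e)"
    unfolding m_def
  proof (rule norm_le_of_entries_le)
    fix i j
    have "\<bar>c j $ i - Z $ i $ j\<bar> = \<bar>c j $ i / norm (c j)\<bar> * \<bar>norm (c j) - 1\<bar>"
    proof -
      have "c j $ i - Z $ i $ j = (c j $ i / norm (c j)) * (norm (c j) - 1)"
        using c_pos[of j] by (simp add: Z_def field_simps)
      then show ?thesis by (simp only: abs_mult)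
    qed
    also have "\<dots> \<le> 1 * (2 * e)"
      using c_norm[of j] component_le_norm_cart[of "c j" i] c_pos[of j]
      by (intro mult_mono) (auto simp: abs_divide)
    finally show "\<bar>(X - Z) $ i $ j\<bar> \<le> 3 * e"
      using XY[of i j] se by (simp add: Yc)
  qed
  finally show ?thesis by (simp add: mult_ac)
qed

lemma sqrt_error_bound_near_stiefel:
  obtains C \<epsilon> where "0 < C" "0 < \<epsilon>" "\<epsilon> \<le> 1"
    "\<And>X :: real^'r^'n. norm (neg_part X) + norm (transpose X ** X - mat 1) \<le> \<epsilon> \<Longrightarrow>
       infdist X nonneg_stiefel
         \<le> C * sqrt (norm (neg_part X) + norm (transpose X ** X - mat 1))"
proof -
  define m where "m = real (CARD('n) * CARD('r))"
  define K where "K = 6 * real CARD('n)"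
  have "1 \<le> real CARD('n)" by (simp add: Suc_leI)
  then have K: "1 \<le> K" unfolding K_def by linarith
  have m: "1 \<le> m" unfolding m_def by (simp del: of_nat_mult add: Suc_leI)
  \<comment> \<open>the largest \<open>d\<close> for which \<open>m * sqrt (K * d) \<le> 1 / 4\<close>\<close>
  define \<epsilon> where "\<epsilon> = 1 / (16 * m\<^sup>2 * K)"
  have m2: "1 \<le> m\<^sup>2 * K" using mult_mono[of 1 "m\<^sup>2" 1 K] m K by (simp add: one_le_power)
  have \<epsilon>: "0 < \<epsilon>" "\<epsilon> \<le> 1" unfolding \<epsilon>_def using m2 by (auto simp: divide_simps mult.assoc)
  have "infdist X nonneg_stiefel \<le> 3 * m\<^sup>2 * sqrt K * sqrt d"
    if d: "norm (neg_part X) + norm (transpose X ** X - mat 1) = d" "d \<le> \<epsilon>"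
    for X :: "real^'r^'n" and d
  proof -
    let ?e = "m * sqrt (6 * CARD('n) * d)"
    have e: "?e = m * sqrt (K * d)" by (simp add: K_def)
    have "m * sqrt (K * d) \<le> m * sqrt (K * \<epsilon>)"
      using d m K by (intro mult_left_mono real_sqrt_le_mono) auto
    also have "K * \<epsilon> = (1 / (4 * m))\<^sup>2"
      using K m by (simp add: \<epsilon>_def power2_eq_square field_simps)
    finally have "?e \<le> 1 / 4" unfolding e using m by simp
    then have "infdist X nonneg_stiefel \<le> 3 * m * ?e"
      unfolding m_def using nearby_stiefel_matrix[OF d(1) refl] d \<epsilon> by simp
    also have "\<dots> = 3 * m\<^sup>2 * sqrt K * sqrt d"
      unfolding e by (simp add: real_sqrt_mult power2_eq_square)
    finally show ?thesis .
  qed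
  moreover have "0 < 3 * m\<^sup>2 * sqrt K" using m K by simp
  ultimately show thesis using that \<epsilon> by blast
qed

section \<open>Lower bounds for distances and exponents\<close>

lemma nonneg_stiefel_nonempty:
  assumes "CARD('r) \<le> CARD('n)"
  shows "(nonneg_stiefel :: (real^'r^'n) set) \<noteq> {}"
proof -
  obtain g :: "'r \<Rightarrow> 'n" where g: "inj g"
    using card_le_inj[of "UNIV :: 'r set" "UNIV :: 'n set"] assms by auto
  have "(\<chi> i j. if i = g j then 1 else 0) \<in> (nonneg_stiefel :: (real^'r^'n) set)"
    by (rule nonneg_stiefelI) (auto simp: if_distrib[of "\<lambda>x. x * _"] inj_eq[OF g] cong: if_cong)
  then show ?thesis by blast
qed

lemma norm_sq_nonneg_stiefel:
  fixes Z :: "real^'r^'n"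
  assumes "Z \<in> nonneg_stiefel"
  shows "(norm Z)\<^sup>2 = CARD('r)"
proof -
  have "transpose Z ** Z = mat 1" using assms by (simp add: nonneg_stiefel_def)
  then show ?thesis by (simp add: norm_sq_eq_trace_gram mat_def)
qed

lemma infdist_geI:
  assumes "S \<noteq> {}" "\<And>z. z \<in> S \<Longrightarrow> c \<le> dist x z"
  shows "c \<le> infdist x S"
  using assms by (simp add: infdist_notempty cINF_greatest)

text \<open>
  The columns of a point of the manifold are orthogonal and nonnegative, so the products of their
  entries vanish row by row: one of its entries in the positions \<open>(i, j)\<close> and \<open>(i, k)\<close> is zero.
\<close>

lemma infdist_nonneg_stiefel_ge_shared_row:
  fixes X :: "real^'r^'n"
  assumes "CARD('r) \<le> CARD('n)" and "j \<noteq> k" and X: "c \<le> X $ i $ j" "c \<le> X $ i $ k"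
  shows "c \<le> infdist X nonneg_stiefel"
proof (rule infdist_geI)
  show "(nonneg_stiefel :: (real^'r^'n) set) \<noteq> {}" using assms(1) by (rule nonneg_stiefel_nonempty)
  fix Z :: "real^'r^'n"
  assume Z: "Z \<in> nonneg_stiefel"
  have "transpose Z ** Z = mat 1" using Z by (simp add: nonneg_stiefel_def)
  then have "(\<Sum>l\<in>UNIV. Z $ l $ j * Z $ l $ k) = 0"
    using \<open>j \<noteq> k\<close> gram_entry[of Z j k] by (simp add: mat_def)
  then have "Z $ i $ j * Z $ i $ k = 0"
    using Z by (subst (asm) sum_nonneg_eq_0_iff) (auto simp: nonneg_stiefel_def)
  then have "Z $ i $ j = 0 \<or> Z $ i $ k = 0" by simp
  then show "c \<le> dist X Z"
    using entry_le_norm[of "X - Z" i j] entry_le_norm[of "X - Z" i k] X by (auto simp: dist_norm)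
qed

text \<open>
  The next two lemmas turn estimates along a curve into conditions on exponents: dividing by \<open>t\<close>
  leaves \<open>C t\<^bsup>p - 1\<^esup>\<close>, which tends to \<open>0\<close> for \<open>t \<rightarrow> 0\<close> if \<open>p > 1\<close>, and for \<open>t \<rightarrow> \<infinity>\<close> if \<open>p < 1\<close>.
\<close>

lemma exponent_le_one_of_small:
  fixes p C :: real
  assumes "0 < t0" and le: "\<And>t. 0 < t \<Longrightarrow> t \<le> t0 \<Longrightarrow> t \<le> C * t powr p"
  shows "p \<le> 1"
proof (rule ccontr)
  assume "\<not> p \<le> 1"
  then have "((\<lambda>t. C * t powr (p - 1)) \<longlongrightarrow> C * 0) (at_right 0)"
    by (intro tendsto_mult tendsto_const tendsto_neg_powr tendsto_zero_powrI)
       (auto intro!: tendsto_eq_intros simp: eventually_at_filter)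
  then have "\<forall>\<^sub>F t in at_right 0. C * t powr (p - 1) < 1"
    by (rule order_tendstoD) simp
  moreover have "\<forall>\<^sub>F t in at_right 0. t \<in> {0<..<t0}"
    using assms(1) by (rule eventually_at_right_real)
  ultimately have "\<forall>\<^sub>F t in at_right (0::real). False"
  proof eventually_elim
    case (elim t)
    then have "t * (C * t powr (p - 1)) < t * 1" by (intro mult_strict_left_mono) auto
    also have "t * (C * t powr (p - 1)) = C * t powr p"
      using elim by (simp add: powr_diff)
    finally show False using le[of t] elim by simp
  qed
  then show False by simp
qed

lemma exponent_ge_one_of_large:
  fixes p C :: real
  assumes le: "\<And>t. 1 \<le> t \<Longrightarrow> t - 1 \<le> C * t powr p"
  shows "1 \<le> p"
proof (rule ccontr)
  assume p: "\<not> 1 \<le> p"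
  have "((\<lambda>t. C * t powr (p - 1) + 1 / t) \<longlongrightarrow> C * 0 + 0) at_top"
    using p by (intro tendsto_add tendsto_mult tendsto_const tendsto_neg_powr
        tendsto_divide_0[OF tendsto_const] filterlim_at_top_imp_at_infinity filterlim_ident) auto
  then have "\<forall>\<^sub>F t in at_top. C * t powr (p - 1) + 1 / t < 1"
    by (rule order_tendstoD) simp
  moreover have "\<forall>\<^sub>F t in at_top. (1::real) \<le> t" by (rule eventually_ge_at_top)
  ultimately have "\<forall>\<^sub>F t in (at_top :: real filter). False"
  proof eventually_elim
    case (elim t)
    then have "t * (C * t powr (p - 1) + 1 / t) < t * 1" by (intro mult_strict_left_mono) auto
    also have "t * (C * t powr (p - 1) + 1 / t) = C * t powr p + 1"
      using elim by (simp add: powr_diff distrib_left)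
    finally show False using le[of t] elim by simp
  qed
  then show False by simp
qed

section \<open>Matrices with two entries in one row\<close>

text \<open>
  Column \<open>j\<close> is the unit vector \<open>e\<^bsub>g j\<^esub>\<close>, perturbed for two indices \<open>a\<close> and \<open>b\<close>, which both get the
  entry \<open>t\<close> in the row \<open>l\<close>. The entry \<open>-s\<close> of column \<open>b\<close> stands in the row where column \<open>a\<close> has its
  \<open>1\<close>, so it lowers the inner product of the two columns from \<open>t\<^sup>2\<close> to \<open>t\<^sup>2 - s\<close>.
\<close>

definition shared_row_column :: "('r \<Rightarrow> 'n::finite) \<Rightarrow> 'n \<Rightarrow> 'r \<Rightarrow> 'r \<Rightarrow> real \<Rightarrow> real \<Rightarrow> 'r \<Rightarrow> real^'n" where
  "shared_row_column g l a b s t j =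
     axis (g j) 1 + (if j = a \<or> j = b then axis l t else 0) - (if j = b then axis (g a) s else 0)"

lemma shared_row_column_inner:
  assumes "inj g" "l \<notin> range g" "a \<noteq> b"
  shows "shared_row_column g l a b s t j \<bullet> shared_row_column g l a b s t k =
    (if j = k then 1 else 0)
    + (if (j = a \<or> j = b) \<and> (k = a \<or> k = b) then t\<^sup>2 else 0)
    - (if j = a \<and> k = b \<or> j = b \<and> k = a then s else 0)
    + (if j = b \<and> k = b then s\<^sup>2 else 0)"
proof -
  have "g x = g y \<longleftrightarrow> x = y" "g x \<noteq> l" "l \<noteq> g x" for x y
    using assms by (auto simp: inj_eq)
  then show ?thesis
    using assms(3) by (auto simp: shared_row_column_def inner_add_left inner_add_right inner_diff_left
        inner_diff_right inner_axis_axis power2_eq_square)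
qed

lemma shared_row_column_nth:
  assumes "inj g" "l \<notin> range g" "a \<noteq> b"
  shows "j = a \<or> j = b \<Longrightarrow> shared_row_column g l a b s t j $ l = t"
    and "0 \<le> s \<Longrightarrow> 0 \<le> t \<Longrightarrow> - s \<le> shared_row_column g l a b s t j $ i"
  using assms by (auto simp: shared_row_column_def axis_def inj_eq)

lemma obtain_shared_row_indices:
  assumes "1 < CARD('r::finite)" "CARD('r) < CARD('n::finite)"
  obtains g :: "'r::finite \<Rightarrow> 'n::finite" and l and a b :: "'r::finite" where "inj g" "l \<notin> range g" "a \<noteq> b"
proof -
  obtain g :: "'r \<Rightarrow> 'n" where g: "inj g"
    using card_le_inj[of "UNIV :: 'r set" "UNIV :: 'n set"] assms by auto
  have "card (range g) < CARD('n)" using assms card_image[OF g] by simp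
  then have "range g \<noteq> UNIV" by auto
  moreover have "\<exists>a b :: 'r. a \<noteq> b"
    using assms(1) by (metis (full_types) One_nat_def UNIV_I card_le_Suc0_iff_eq finite not_less)
  ultimately show thesis using that g by blast
qed

text \<open>
  Test the error bound on the matrices with \<open>s = 0\<close>: they are nonnegative, at distance at least
  \<open>t\<close> from the manifold, and their Gram matrix differs from \<open>I\<close> by entries of size at most \<open>t\<^sup>2\<close>. Only an
  upper bound for \<open>\<rho>\<close> is involved, so both residual functions are covered.
\<close>

lemma gram_exponent_le_half:
  fixes \<rho> :: "real^'r^'n \<Rightarrow> real"
  assumes card: "1 < CARD('r)" "CARD('r) < CARD('n)" and loc: "local_error_bound \<rho>"
    and q: "0 < q\<^sub>2"
    and upper: "\<And>X. \<rho> X \<le> norm (neg_part X) powr q\<^sub>1 + norm (transpose X ** X - mat 1) powr q\<^sub>2"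
  shows "q\<^sub>2 \<le> 1 / 2"
proof -
  obtain g :: "'r \<Rightarrow> 'n" and l and a b :: 'r
    where g: "inj g" "l \<notin> range g" "a \<noteq> b"
    by (rule obtain_shared_row_indices[OF card])
  obtain \<epsilon> \<nu> where e: "0 < \<epsilon>" "0 < \<nu>" and bound:
    "\<And>X. norm (neg_part X) + norm (transpose X ** X - mat 1) \<le> \<epsilon> \<Longrightarrow>
       infdist X nonneg_stiefel \<le> \<nu> * \<rho> X"
    using loc unfolding local_error_bound_def by metis
  define m where "m = real (CARD('r) * CARD('r))"
  have m: "0 < m" by (simp add: m_def)
  define t0 where "t0 = sqrt (\<epsilon> / m)"
  have t0: "0 < t0" unfolding t0_def using e m by simp
  have "t \<le> (\<nu> * m powr q\<^sub>2) * t powr (2 * q\<^sub>2)" if t: "0 < t" "t \<le> t0" for t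
  proof -
    define X :: "real^'r^'n" where "X = (\<chi> i j. shared_row_column g l a b 0 t j $ i)"
    have "neg_part X = 0"
      using shared_row_column_nth(2)[OF g, of 0 t] t by (simp add: neg_part_def X_def vec_eq_iff max_def)
    have "norm (transpose X ** X - mat 1) \<le> m * t\<^sup>2"
      unfolding m_def
    proof (rule norm_le_of_entries_le)
      fix j k
      have "(transpose X ** X) $ j $ k
          = shared_row_column g l a b 0 t j \<bullet> shared_row_column g l a b 0 t k"
        by (simp add: gram_entry X_def inner_vec_def)
      then show "\<bar>(transpose X ** X - mat 1) $ j $ k\<bar> \<le> t\<^sup>2"
        by (simp add: shared_row_column_inner[OF g] mat_def)
    qed
    moreover have "m * t\<^sup>2 \<le> \<epsilon>"
    proof -
      have "t\<^sup>2 \<le> t0\<^sup>2" using t by (intro power_mono) auto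
      then show ?thesis using m e by (simp add: t0_def field_simps)
    qed
    ultimately have "t \<le> \<nu> * \<rho> X"
      using \<open>neg_part X = 0\<close> bound[of X] shared_row_column_nth(1)[OF g]
        infdist_nonneg_stiefel_ge_shared_row[OF less_imp_le[OF card(2)] g(3), of t X l]
      by (simp add: X_def)
    also have "\<rho> X \<le> (m * t\<^sup>2) powr q\<^sub>2"
      using upper[of X] \<open>neg_part X = 0\<close> q
        powr_mono2[OF less_imp_le[OF q] norm_ge_zero \<open>norm (transpose X ** X - mat 1) \<le> m * t\<^sup>2\<close>]
      by simp
    also have "(m * t\<^sup>2) powr q\<^sub>2 = m powr q\<^sub>2 * t powr (2 * q\<^sub>2)"
      using t m by (simp add: powr_mult powr_powr flip: powr_numeral)
    finally show ?thesis using e by (simp add: mult_ac)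
  qed
  then have "2 * q\<^sub>2 \<le> 1"
    by (rule exponent_le_one_of_small[OF t0])
  then show ?thesis by simp
qed

text \<open>
  With \<open>s = t\<^sup>2\<close> the columns are orthogonal. Normalizing them makes the Gram matrix exactly \<open>I\<close>; the
  column norms lie between \<open>1\<close> and \<open>2\<close>, so the negative entry keeps its size of at most \<open>t\<^sup>2\<close> and
  the two entries in the common row are still at least \<open>t / 2\<close>.
\<close>

lemma neg_part_exponent_le_half:
  fixes \<rho> :: "real^'r^'n \<Rightarrow> real"
  assumes card: "1 < CARD('r)" "CARD('r) < CARD('n)" and loc: "local_error_bound \<rho>"
    and q: "0 < q\<^sub>1"
    and upper: "\<And>X. \<rho> X \<le> norm (neg_part X) powr q\<^sub>1 + norm (transpose X ** X - mat 1) powr q\<^sub>2"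
  shows "q\<^sub>1 \<le> 1 / 2"
proof -
  obtain g :: "'r \<Rightarrow> 'n" and l and a b :: 'r
    where g: "inj g" "l \<notin> range g" "a \<noteq> b"
    by (rule obtain_shared_row_indices[OF card])
  obtain \<epsilon> \<nu> where e: "0 < \<epsilon>" "0 < \<nu>" and bound:
    "\<And>X. norm (neg_part X) + norm (transpose X ** X - mat 1) \<le> \<epsilon> \<Longrightarrow>
       infdist X nonneg_stiefel \<le> \<nu> * \<rho> X"
    using loc unfolding local_error_bound_def by metis
  define m where "m = real (CARD('n) * CARD('r))"
  have m: "0 < m" by (simp add: m_def)
  define t0 where "t0 = min 1 (sqrt (\<epsilon> / m))"
  have t0: "0 < t0" unfolding t0_def using e m by simp
  have "t \<le> (2 * \<nu> * m powr q\<^sub>1) * t powr (2 * q\<^sub>1)" if t: "0 < t" "t \<le> t0" for t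
  proof -
    have t1: "t \<le> 1" "t \<le> sqrt (\<epsilon> / m)" using t by (auto simp: t0_def)
    define u where "u = shared_row_column g l a b (t\<^sup>2) t"
    have u_inner: "u j \<bullet> u k = (if j = k then if j = a then 1 + t\<^sup>2
        else if j = b then 1 + t\<^sup>2 + (t\<^sup>2)\<^sup>2 else 1 else 0)" for j k
      unfolding u_def shared_row_column_inner[OF g] using g(3) by auto
    have tt: "t\<^sup>2 \<le> 1" "(t\<^sup>2)\<^sup>2 \<le> 1" using t t1 by (auto intro!: power_le_one)
    have u_ge: "1 \<le> norm (u j)" and u_le: "norm (u j) \<le> 2" for j
      using tt by (auto simp: norm_eq_sqrt_inner u_inner intro!: real_le_lsqrt)
    define X :: "real^'r^'n" where "X = (\<chi> i j. u j $ i / norm (u j))"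
    have "transpose X ** X = mat 1"
    proof -
      have "(transpose X ** X) $ j $ k = (u j \<bullet> u k) / (norm (u j) * norm (u k))" for j k
        by (simp add: gram_entry X_def inner_vec_def sum_divide_distrib)
      moreover have "(u j \<bullet> u k) / (norm (u j) * norm (u k)) = (if j = k then 1 else 0)" for j k
      proof (cases "j = k")
        case True
        then show ?thesis using u_ge[of k] by (auto simp: dot_square_norm power2_eq_square)
      qed (simp add: u_inner)
      ultimately show ?thesis by (simp add: vec_eq_iff mat_def)
    qed
    have "norm (neg_part X) \<le> m * t\<^sup>2"
      unfolding m_def
    proof (rule norm_le_of_entries_le)
      fix i j
      have "- t\<^sup>2 \<le> u j $ i" unfolding u_def using t by (intro shared_row_column_nth(2)[OF g]) auto
      moreover have "t\<^sup>2 \<le> t\<^sup>2 * norm (u j)" using u_ge[of j] by (simp add: mult_le_cancel_left1)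
      ultimately have "- (u j $ i) \<le> t\<^sup>2 * norm (u j)" by linarith
      moreover have "0 < norm (u j)" using u_ge[of j] by linarith
      ultimately have "- (u j $ i) / norm (u j) \<le> t\<^sup>2" by (simp only: pos_divide_le_eq)
      then show "\<bar>neg_part X $ i $ j\<bar> \<le> t\<^sup>2"
        by (simp add: neg_part_def X_def)
    qed
    moreover have "m * t\<^sup>2 \<le> \<epsilon>"
    proof -
      have "t\<^sup>2 \<le> (sqrt (\<epsilon> / m))\<^sup>2" using t t1 by (intro power_mono) auto
      then show ?thesis using m e by (simp add: field_simps)
    qed
    moreover have "t / 2 \<le> infdist X nonneg_stiefel"
    proof (rule infdist_nonneg_stiefel_ge_shared_row[OF less_imp_le[OF card(2)] g(3)])
      have "t / 2 \<le> t / norm (u j)" for j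
        using t u_ge[of j] u_le[of j] by (intro divide_left_mono) auto
      then show "t / 2 \<le> X $ l $ a" "t / 2 \<le> X $ l $ b"
        by (simp_all add: X_def) (simp_all add: u_def shared_row_column_nth(1)[OF g])
    qed
    ultimately have "t / 2 \<le> \<nu> * \<rho> X"
      using \<open>transpose X ** X = mat 1\<close> bound[of X] by simp
    also have "\<rho> X \<le> (m * t\<^sup>2) powr q\<^sub>1"
      using upper[of X] \<open>transpose X ** X = mat 1\<close> q
        powr_mono2[OF less_imp_le[OF q] norm_ge_zero \<open>norm (neg_part X) \<le> m * t\<^sup>2\<close>]
      by simp
    also have "(m * t\<^sup>2) powr q\<^sub>1 = m powr q\<^sub>1 * t powr (2 * q\<^sub>1)"
      using t m by (simp add: powr_mult powr_powr flip: powr_numeral)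
    finally show ?thesis using e by (simp add: mult_ac)
  qed
  then have "2 * q\<^sub>1 \<le> 1"
    by (rule exponent_le_one_of_small[OF t0])
  then show ?thesis by simp
qed

section \<open>Comparison of the two residual functions and the local bounds\<close>

text \<open>
  For numbers in \<open>[0, 1]\<close> lowering an exponent increases the power, so the square-root bound
  implies the bound for all smaller exponents.
\<close>

lemma local_error_bound_of_small_exponents:
  fixes \<rho> :: "real^'r^'n \<Rightarrow> real"
  assumes q: "q\<^sub>1 \<le> 1 / 2" "q\<^sub>2 \<le> 1 / 2"
    and nonneg: "\<And>X. 0 \<le> \<rho> X" and K: "0 < K"
    and lower: "\<And>X. norm (neg_part X) + norm (transpose X ** X - mat 1) \<le> 1 \<Longrightarrow>
      norm (neg_part X) powr q\<^sub>1 + norm (transpose X ** X - mat 1) powr q\<^sub>2 \<le> K * \<rho> X"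
  shows "local_error_bound \<rho>"
proof -
  obtain C \<epsilon> where C: "0 < C" and e: "0 < \<epsilon>" "\<epsilon> \<le> 1"
    and near: "\<And>X :: real^'r^'n. norm (neg_part X) + norm (transpose X ** X - mat 1) \<le> \<epsilon> \<Longrightarrow>
       infdist X nonneg_stiefel
         \<le> C * sqrt (norm (neg_part X) + norm (transpose X ** X - mat 1))"
    using sqrt_error_bound_near_stiefel[where 'r = 'r and 'n = 'n] by blast
  have "infdist X nonneg_stiefel \<le> (C * K) * \<rho> X"
    if X: "norm (neg_part X) + norm (transpose X ** X - mat 1) \<le> \<epsilon>" for X
  proof -
    define a b where "a = norm (neg_part X)" and "b = norm (transpose X ** X - mat 1)"
    have ab: "0 \<le> a" "0 \<le> b" by (simp_all add: a_def b_def)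
    have ab1: "a \<le> 1" "b \<le> 1" "a + b \<le> 1" using ab X e unfolding a_def[symmetric] b_def[symmetric] by auto
    have "sqrt (a + b) \<le> sqrt a + sqrt b"
      using ab by (rule sqrt_add_le_add_sqrt)
    also have "\<dots> \<le> a powr q\<^sub>1 + b powr q\<^sub>2"
      unfolding powr_half_sqrt[OF ab(1), symmetric] powr_half_sqrt[OF ab(2), symmetric]
      using q ab ab1 by (intro add_mono powr_mono') auto
    also have "\<dots> \<le> K * \<rho> X" using lower[of X] ab1 by (simp add: a_def b_def)
    finally have "C * sqrt (a + b) \<le> C * (K * \<rho> X)" using C by (intro mult_left_mono) auto
    with near[OF X] show ?thesis by (simp add: a_def b_def mult.assoc)
  qed
  with nonneg e C K show ?thesis
    unfolding local_error_bound_def by (meson mult_pos_pos)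
qed

lemma rho1_eq:
  "rho1 q\<^sub>1 q\<^sub>2 X = norm (neg_part X) powr q\<^sub>1 + singular_value_deviation X powr q\<^sub>2"
  by (simp add: rho1_def singular_value_deviation_def)

lemma rho_nonneg: "0 \<le> rho1 q\<^sub>1 q\<^sub>2 X" "0 \<le> rho2 q\<^sub>1 q\<^sub>2 X"
  by (simp_all add: rho1_def rho2_def)

lemma rho1_le_rho2: "0 \<le> q\<^sub>2 \<Longrightarrow> rho1 q\<^sub>1 q\<^sub>2 X \<le> rho2 q\<^sub>1 q\<^sub>2 X"
  unfolding rho1_eq rho2_def
  by (intro add_left_mono powr_mono2 singular_value_deviation_nonneg singular_value_deviation_le_gram)

lemma rho2_le_rho1_near_stiefel:
  assumes "0 \<le> q\<^sub>2" and "norm (transpose X ** X - mat 1) \<le> 1"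
  shows "rho2 q\<^sub>1 q\<^sub>2 X \<le> 3 powr q\<^sub>2 * rho1 q\<^sub>1 q\<^sub>2 X"
proof -
  have "norm (transpose X ** X - mat 1) powr q\<^sub>2 \<le> (3 * singular_value_deviation X) powr q\<^sub>2"
    using assms by (intro powr_mono2 gram_le_singular_value_deviation) auto
  also have "\<dots> = 3 powr q\<^sub>2 * singular_value_deviation X powr q\<^sub>2"
    by (simp add: powr_mult singular_value_deviation_nonneg)
  moreover have "1 * norm (neg_part X) powr q\<^sub>1 \<le> 3 powr q\<^sub>2 * norm (neg_part X) powr q\<^sub>1"
    using assms(1) by (intro mult_right_mono ge_one_powr_ge_zero) auto
  ultimately show ?thesis by (simp add: rho1_eq rho2_def distrib_left)
qed

lemma global_imp_local_error_bound: "global_error_bound \<rho> \<Longrightarrow> local_error_bound \<rho>"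
  unfolding global_error_bound_def local_error_bound_def by (meson zero_less_one)

section \<open>Global behaviour\<close>

text \<open>
  All points of the manifold have the same norm \<open>sqrt r \<ge> 1\<close>, so \<open>tZ\<close> has distance at least
  \<open>(t - 1) sqrt r\<close> from it.
\<close>

lemma gram_scaled_stiefel:
  fixes Z :: "real^'r^'n"
  assumes "Z \<in> nonneg_stiefel" "1 \<le> t"
  shows "neg_part (t *\<^sub>R Z) = 0"
    and "norm (transpose (t *\<^sub>R Z) ** (t *\<^sub>R Z) - mat 1) \<le> norm (mat 1 :: real^'r^'r) * t\<^sup>2"
    and "t - 1 \<le> infdist (t *\<^sub>R Z) nonneg_stiefel"
proof -
  show "neg_part (t *\<^sub>R Z) = 0"
    using assms by (simp add: neg_part_def nonneg_stiefel_def vec_eq_iff max_def)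
  have "(transpose (t *\<^sub>R Z) ** (t *\<^sub>R Z)) $ j $ k = t\<^sup>2 * (transpose Z ** Z) $ j $ k" for j k
    by (simp add: gram_entry power2_eq_square sum_distrib_left mult_ac)
  then have "transpose (t *\<^sub>R Z) ** (t *\<^sub>R Z) - mat 1 = (t\<^sup>2 - 1) *\<^sub>R mat 1"
    using assms(1) by (simp add: vec_eq_iff nonneg_stiefel_def algebra_simps)
  moreover have "\<bar>t\<^sup>2 - 1\<bar> \<le> t\<^sup>2" using one_le_power[OF assms(2), of 2] by simp
  ultimately show "norm (transpose (t *\<^sub>R Z) ** (t *\<^sub>R Z) - mat 1) \<le> norm (mat 1 :: real^'r^'r) * t\<^sup>2"
    by (simp add: mult.commute mult_left_mono)
  show "t - 1 \<le> infdist (t *\<^sub>R Z) nonneg_stiefel"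
  proof (rule infdist_geI)
    fix Y :: "real^'r^'n" assume Y: "Y \<in> nonneg_stiefel"
    have n: "norm Z = norm Y"
      by (rule power2_eq_imp_eq) (simp_all add: norm_sq_nonneg_stiefel Y assms(1))
    have "1 \<le> norm Z"
      by (rule power2_le_imp_le) (simp_all add: norm_sq_nonneg_stiefel assms(1) Suc_leI)
    then have "(t - 1) * 1 \<le> (t - 1) * norm Z" using assms by (intro mult_left_mono) auto
    also have "\<dots> = norm (t *\<^sub>R Z) - norm Y" using n assms by (simp add: algebra_simps)
    also have "\<dots> \<le> dist (t *\<^sub>R Z) Y" unfolding dist_norm by (rule norm_triangle_ineq2)
    finally show "t - 1 \<le> dist (t *\<^sub>R Z) Y" by simp
  qed (use assms in auto)
qed

lemma global_rho2_exponent_ge_half: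
  assumes "CARD('r) \<le> CARD('n)" "0 < q\<^sub>2"
    and "global_error_bound (rho2 q\<^sub>1 q\<^sub>2 :: real^'r^'n \<Rightarrow> real)"
  shows "1 / 2 \<le> q\<^sub>2"
proof -
  obtain Z :: "real^'r^'n" where Z: "Z \<in> nonneg_stiefel"
    using nonneg_stiefel_nonempty[OF assms(1)] by auto
  obtain \<nu> where \<nu>: "0 < \<nu>" "\<And>X :: real^'r^'n. infdist X nonneg_stiefel \<le> \<nu> * rho2 q\<^sub>1 q\<^sub>2 X"
    using assms(3) unfolding global_error_bound_def by blast
  let ?c = "norm (mat 1 :: real^'r^'r)"
  have "t - 1 \<le> (\<nu> * ?c powr q\<^sub>2) * t powr (2 * q\<^sub>2)" if "1 \<le> t" for t
  proof -
    note tZ = gram_scaled_stiefel[OF Z that]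
    have "rho2 q\<^sub>1 q\<^sub>2 (t *\<^sub>R Z) \<le> (?c * t\<^sup>2) powr q\<^sub>2"
      using assms tZ(1) powr_mono2[OF less_imp_le[OF assms(2)] norm_ge_zero tZ(2)]
      by (simp add: rho2_def)
    also have "\<dots> = ?c powr q\<^sub>2 * t powr (2 * q\<^sub>2)"
      using that by (simp add: powr_mult powr_powr flip: powr_numeral)
    finally have "\<nu> * rho2 q\<^sub>1 q\<^sub>2 (t *\<^sub>R Z) \<le> \<nu> * (?c powr q\<^sub>2 * t powr (2 * q\<^sub>2))"
      using \<nu>(1) by simp
    with tZ(3) \<nu>(2)[of "t *\<^sub>R Z"] show ?thesis by (simp add: mult.assoc)
  qed
  then have "1 \<le> 2 * q\<^sub>2" by (rule exponent_ge_one_of_large)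
  then show ?thesis by simp
qed

text \<open>
  Along the ray through a point of the manifold the singular values grow only linearly, so the
  linear growth of the distance already exhausts the exponent \<open>1\<close>.
\<close>

lemma global_rho1_exponent_ge_one:
  assumes "CARD('r) \<le> CARD('n)" "0 < q\<^sub>2"
    and "global_error_bound (rho1 q\<^sub>1 q\<^sub>2 :: real^'r^'n \<Rightarrow> real)"
  shows "1 \<le> q\<^sub>2"
proof -
  obtain Z :: "real^'r^'n" where Z: "Z \<in> nonneg_stiefel"
    using nonneg_stiefel_nonempty[OF assms(1)] by auto
  obtain \<nu> where \<nu>: "0 < \<nu>" "\<And>X :: real^'r^'n. infdist X nonneg_stiefel \<le> \<nu> * rho1 q\<^sub>1 q\<^sub>2 X"
    using assms(3) unfolding global_error_bound_def by blast
  define c where "c = sqrt (CARD('r) * norm (mat 1 :: real^'r^'r))"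
  have c: "0 \<le> c" by (simp add: c_def)
  have "t - 1 \<le> (\<nu> * c powr q\<^sub>2) * t powr q\<^sub>2" if "1 \<le> t" for t
  proof -
    note tZ = gram_scaled_stiefel[OF Z that]
    have "(singular_value_deviation (t *\<^sub>R Z))\<^sup>2
        \<le> CARD('r) * norm (transpose (t *\<^sub>R Z) ** (t *\<^sub>R Z) - mat 1)"
      by (rule singular_value_deviation_sq_le_gram)
    also have "\<dots> \<le> CARD('r) * (norm (mat 1 :: real^'r^'r) * t\<^sup>2)"
      using tZ(2) by (intro mult_left_mono) auto
    also have "\<dots> = (c * t)\<^sup>2" by (simp add: c_def power_mult_distrib)
    finally have "singular_value_deviation (t *\<^sub>R Z) \<le> c * t"
      by (rule power2_le_imp_le) (use c that in simp)
    then have "rho1 q\<^sub>1 q\<^sub>2 (t *\<^sub>R Z) \<le> (c * t) powr q\<^sub>2"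
      using assms tZ(1) powr_mono2[OF less_imp_le[OF assms(2)] singular_value_deviation_nonneg]
      by (simp add: rho1_eq)
    also have "\<dots> = c powr q\<^sub>2 * t powr q\<^sub>2" using c that by (simp add: powr_mult)
    finally have "\<nu> * rho1 q\<^sub>1 q\<^sub>2 (t *\<^sub>R Z) \<le> \<nu> * (c powr q\<^sub>2 * t powr q\<^sub>2)"
      using \<nu>(1) by simp
    with tZ(3) \<nu>(2)[of "t *\<^sub>R Z"] show ?thesis by (simp add: mult.assoc)
  qed
  then show ?thesis by (rule exponent_ge_one_of_large)
qed

lemma infdist_le_norm_plus:
  assumes "Z \<in> S"
  shows "infdist X S \<le> norm X + norm Z"
  using infdist_le[OF assms, of X] norm_triangle_ineq4[of X Z] by (simp add: dist_norm)

lemma norm_sq_le_gram_defect: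
  fixes X :: "real^'r^'n"
  shows "(norm X)\<^sup>2
    \<le> CARD('r) * (norm (transpose X ** X - mat 1) + norm (mat 1 :: real^'r^'r))"
proof -
  have "(norm X)\<^sup>2 \<le> (\<Sum>j\<in>(UNIV :: 'r set). norm (transpose X ** X))"
    unfolding norm_sq_eq_trace_gram by (intro sum_mono order_trans[OF abs_ge_self entry_le_norm])
  also have "\<dots> = CARD('r) * norm ((transpose X ** X - mat 1) + mat 1)" by simp
  also have "\<dots> \<le> CARD('r) * (norm (transpose X ** X - mat 1) + norm (mat 1 :: real^'r^'r))"
    by (intro mult_left_mono norm_triangle_ineq) auto
  finally show ?thesis .
qed

text \<open>
  Outside the region of the local bound either \<open>b = \<parallel>X\<^sup>TX - I\<parallel>\<close> or \<open>a = \<parallel>X\<^sub>-\<parallel>\<close> is at least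
  \<open>h = \<epsilon> / 2\<close>. The distance is at most \<open>\<parallel>X\<parallel> + \<parallel>Z\<parallel>\<close> for any fixed point \<open>Z\<close> of the manifold, and
  \<open>\<parallel>X\<parallel>\<^sup>2\<close> grows at most linearly in \<open>b\<close>. So for \<open>b \<ge> h\<close> the term \<open>sqrt b\<close> dominates; here the
  exponent \<open>1/2\<close> matters. For \<open>b \<le> h \<le> a\<close> the distance is bounded by a constant, while
  \<open>a powr q\<^sub>1\<close> is at least \<open>h powr q\<^sub>1\<close>.
\<close>

lemma global_error_bound_rho2_half:
  fixes q\<^sub>1 :: real
  assumes card: "CARD('r) \<le> CARD('n)" and q: "0 < q\<^sub>1"
    and loc: "local_error_bound (rho2 q\<^sub>1 (1 / 2) :: real^'r^'n \<Rightarrow> real)"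
  shows "global_error_bound (rho2 q\<^sub>1 (1 / 2) :: real^'r^'n \<Rightarrow> real)"
proof -
  obtain Z :: "real^'r^'n" where Z: "Z \<in> nonneg_stiefel"
    using nonneg_stiefel_nonempty[OF card] by auto
  obtain \<epsilon> \<nu> where e: "0 < \<epsilon>" "0 < \<nu>" and near:
    "\<And>X :: real^'r^'n. norm (neg_part X) + norm (transpose X ** X - mat 1) \<le> \<epsilon> \<Longrightarrow>
       infdist X nonneg_stiefel \<le> \<nu> * rho2 q\<^sub>1 (1 / 2) X"
    using loc unfolding local_error_bound_def by metis
  define r c where "r = real CARD('r)" and "c = norm (mat 1 :: real^'r^'r)"
  have rc: "0 \<le> r" "0 \<le> c" by (simp_all add: r_def c_def)
  define h where "h = \<epsilon> / 2"
  have h: "0 < h" using e by (simp add: h_def)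
  define A where "A = sqrt (r * (h + c)) + norm Z"
  have A: "0 \<le> A" using rc h by (simp add: A_def)
  \<comment> \<open>\<open>s = sqrt (b / h)\<close> serves the case \<open>b \<ge> h\<close>, and \<open>s = 1\<close> the case \<open>b \<le> h\<close>\<close>
  have far: "infdist X nonneg_stiefel \<le> A * s"
    if "norm (transpose X ** X - mat 1) \<le> h * s\<^sup>2" "1 \<le> s" for X :: "real^'r^'n" and s
  proof -
    have "1 \<le> s\<^sup>2" using that(2) by (rule one_le_power)
    then have "c * 1 \<le> c * s\<^sup>2" using rc by (intro mult_left_mono)
    then have "r * (norm (transpose X ** X - mat 1) + c) \<le> r * (h * s\<^sup>2 + c * s\<^sup>2)"
      using that rc by (intro mult_left_mono) auto
    with norm_sq_le_gram_defect[of X]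
    have "(norm X)\<^sup>2 \<le> (r * (h + c)) * s\<^sup>2" by (simp add: r_def c_def algebra_simps)
    also have "\<dots> = (sqrt (r * (h + c)) * s)\<^sup>2" using rc h by (simp add: power_mult_distrib)
    finally have "norm X \<le> sqrt (r * (h + c)) * s"
      by (rule power2_le_imp_le) (use rc h that in simp)
    moreover have "norm Z * 1 \<le> norm Z * s" using that by (intro mult_left_mono) auto
    ultimately show ?thesis
      using infdist_le_norm_plus[OF Z, of X] by (simp add: A_def algebra_simps)
  qed
  define N where "N = \<nu> + A / sqrt h + A / h powr q\<^sub>1"
  have N: "\<nu> \<le> N" "A / sqrt h \<le> N" "A / h powr q\<^sub>1 \<le> N"
    using e A h by (auto simp: N_def)
  have "infdist X nonneg_stiefel \<le> N * rho2 q\<^sub>1 (1 / 2) X" for X :: "real^'r^'n"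
  proof -
    define a b where "a = norm (neg_part X)" and "b = norm (transpose X ** X - mat 1)"
    have ab: "0 \<le> a" "0 \<le> b" by (simp_all add: a_def b_def)
    have rho: "rho2 q\<^sub>1 (1 / 2) X = a powr q\<^sub>1 + sqrt b"
      using ab by (simp add: rho2_def a_def b_def powr_half_sqrt)
    consider "a + b \<le> \<epsilon>" | "h \<le> b" | "b \<le> h" "h \<le> a" unfolding h_def by linarith
    then have "infdist X nonneg_stiefel \<le> \<nu> * (a powr q\<^sub>1 + sqrt b) \<or>
      infdist X nonneg_stiefel \<le> (A / sqrt h) * (a powr q\<^sub>1 + sqrt b) \<or>
      infdist X nonneg_stiefel \<le> (A / h powr q\<^sub>1) * (a powr q\<^sub>1 + sqrt b)"
    proof cases
      case 1
      then show ?thesis using near[of X] rho by (simp add: a_def b_def)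
    next
      case 2
      have "infdist X nonneg_stiefel \<le> A * sqrt (b / h)"
        using 2 h ab by (intro far) (auto simp: b_def)
      also have "\<dots> = (A / sqrt h) * sqrt b" by (simp add: real_sqrt_divide)
      also have "\<dots> \<le> (A / sqrt h) * (a powr q\<^sub>1 + sqrt b)"
        using A h by (intro mult_left_mono) auto
      finally show ?thesis by blast
    next
      case 3
      have "infdist X nonneg_stiefel \<le> A * 1"
        using 3 by (intro far) (auto simp: b_def)
      also have "\<dots> = (A / h powr q\<^sub>1) * h powr q\<^sub>1" using h by simp
      also have "\<dots> \<le> (A / h powr q\<^sub>1) * (a powr q\<^sub>1 + sqrt b)"
        using A h ab 3 q powr_mono2[of q\<^sub>1 h a] by (intro mult_left_mono) (auto intro: add_increasing2)
      finally show ?thesis by blast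
    qed
    moreover have "0 \<le> a powr q\<^sub>1 + sqrt b" using ab by simp
    ultimately show ?thesis unfolding rho
      using mult_right_mono[OF N(1)] mult_right_mono[OF N(2)] mult_right_mono[OF N(3)]
      by (meson order_trans)
  qed
  moreover have "0 < N" using e N by linarith
  ultimately show ?thesis unfolding global_error_bound_def by (auto simp: rho_nonneg)
qed

section \<open>The error bounds\<close>

theorem theorem6:
  fixes q\<^sub>1 q\<^sub>2 :: real
  assumes "0 < q\<^sub>1" "0 < q\<^sub>2"
    and "1 < CARD('r::finite)" "CARD('r) < CARD('n::finite)"
  shows "(local_error_bound (rho1 q\<^sub>1 q\<^sub>2 :: real^'r^'n \<Rightarrow> real)
            \<longleftrightarrow> q\<^sub>1 \<le> 1/2 \<and> q\<^sub>2 \<le> 1/2)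
       \<and> \<not> global_error_bound (rho1 q\<^sub>1 q\<^sub>2 :: real^'r^'n \<Rightarrow> real)
       \<and> (local_error_bound (rho2 q\<^sub>1 q\<^sub>2 :: real^'r^'n \<Rightarrow> real)
            \<longleftrightarrow> q\<^sub>1 \<le> 1/2 \<and> q\<^sub>2 \<le> 1/2)
       \<and> (global_error_bound (rho2 q\<^sub>1 q\<^sub>2 :: real^'r^'n \<Rightarrow> real)
            \<longleftrightarrow> q\<^sub>1 \<le> q\<^sub>2 \<and> q\<^sub>2 = 1/2)"
proof -
  have card: "CARD('r) \<le> CARD('n)" using assms(4) by simp
  have upper1: "rho1 q\<^sub>1 q\<^sub>2 X
      \<le> norm (neg_part X) powr q\<^sub>1 + norm (transpose X ** X - mat 1) powr q\<^sub>2" for X :: "real^'r^'n"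
    using rho1_le_rho2[of q\<^sub>2 q\<^sub>1 X] assms(2) by (simp add: rho2_def)
  have upper2: "rho2 q\<^sub>1 q\<^sub>2 X
      \<le> norm (neg_part X) powr q\<^sub>1 + norm (transpose X ** X - mat 1) powr q\<^sub>2" for X :: "real^'r^'n"
    by (simp add: rho2_def)
  have exps: "q\<^sub>1 \<le> 1/2 \<and> q\<^sub>2 \<le> 1/2" if "local_error_bound \<rho>"
    "\<And>X. \<rho> X \<le> norm (neg_part X) powr q\<^sub>1 + norm (transpose X ** X - mat 1) powr q\<^sub>2"
    for \<rho> :: "real^'r^'n \<Rightarrow> real"
    using neg_part_exponent_le_half[OF assms(3,4) that(1) assms(1) that(2)]
      gram_exponent_le_half[OF assms(3,4) that(1) assms(2) that(2)] by simp
  have loc1: "local_error_bound (rho1 q\<^sub>1 q\<^sub>2 :: real^'r^'n \<Rightarrow> real)" if "q\<^sub>1 \<le> 1/2" "q\<^sub>2 \<le> 1/2"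
  proof (rule local_error_bound_of_small_exponents[OF that])
    fix X :: "real^'r^'n"
    assume "norm (neg_part X) + norm (transpose X ** X - mat 1) \<le> 1"
    then have "norm (transpose X ** X - mat 1) \<le> 1"
      using norm_ge_zero[of "neg_part X"] by linarith
    then show "norm (neg_part X) powr q\<^sub>1 + norm (transpose X ** X - mat 1) powr q\<^sub>2
        \<le> 3 powr q\<^sub>2 * rho1 q\<^sub>1 q\<^sub>2 X"
      using rho2_le_rho1_near_stiefel[of q\<^sub>2 X q\<^sub>1] assms(2) by (simp add: rho2_def)
  qed (simp_all add: rho_nonneg)
  have loc2: "local_error_bound (rho2 q\<^sub>1 q\<^sub>2 :: real^'r^'n \<Rightarrow> real)" if "q\<^sub>1 \<le> 1/2" "q\<^sub>2 \<le> 1/2"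
    by (rule local_error_bound_of_small_exponents[OF that, where K = 1])
       (simp_all add: rho_nonneg rho2_def)
  have "\<not> global_error_bound (rho1 q\<^sub>1 q\<^sub>2 :: real^'r^'n \<Rightarrow> real)"
    using global_rho1_exponent_ge_one[OF card assms(2)]
      exps[OF global_imp_local_error_bound upper1] by fastforce
  moreover have "global_error_bound (rho2 q\<^sub>1 q\<^sub>2 :: real^'r^'n \<Rightarrow> real)
      \<longleftrightarrow> q\<^sub>1 \<le> q\<^sub>2 \<and> q\<^sub>2 = 1/2"
  proof
    assume g: "global_error_bound (rho2 q\<^sub>1 q\<^sub>2 :: real^'r^'n \<Rightarrow> real)"
    then show "q\<^sub>1 \<le> q\<^sub>2 \<and> q\<^sub>2 = 1/2"
      using global_rho2_exponent_ge_half[OF card assms(2) g]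
        exps[OF global_imp_local_error_bound[OF g] upper2] by linarith
  next
    assume q: "q\<^sub>1 \<le> q\<^sub>2 \<and> q\<^sub>2 = 1/2"
    then have "q\<^sub>2 = 1/2" "local_error_bound (rho2 q\<^sub>1 q\<^sub>2 :: real^'r^'n \<Rightarrow> real)"
      using loc2 by auto
    then show "global_error_bound (rho2 q\<^sub>1 q\<^sub>2 :: real^'r^'n \<Rightarrow> real)"
      using global_error_bound_rho2_half[OF card assms(1)] by blast
  qed
  ultimately show ?thesis
    using loc1 loc2 exps[OF _ upper1] exps[OF _ upper2] by blast
qed

end
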